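(* Let $f:\mathbb{N}\to\mathbb{N}$ be a function with $\max_n f(n)=N$. Let $t=\max(2, t_0)$ where $t_0$ is the largest integer $t'$ with $t'^{\,e t'}\leq N$ (and $t=2$ if no integer $t'\ge 2$ satisfies this). Then there is an absolute constant $C$ (independent of $n$, $f$, $N$) such that for every $n$, every $w\in\{0,1\}^n$ and every $\mathcal{B}\subseteq\{0,1\}^n\setminus\{w\}$ with $|\mathcal{B}|=f(n)$, there is a first-order sentence over $\tau_{\mathsf{string}}$ with at most $\log_2(n)+\log_t(N)+C$ quantifiers true in $\mathbf{B}_w$ and false in $\mathbf{B}_{w'}$ for all $w'\in\mathcal{B}$.
   Context: Here $e$ is Euler's number. Vocabulary $\tau_{\mathsf{string}}=\langle <, S;\ \mathsf{min},\mathsf{max}\rangle$ with $<$ binary, $S$ unary, $\mathsf{min},\mathsf{max}$ constants. A string $w=w_1\cdots w_n\in\{0,1\}^n$ ($n\geq 1$) is encoded by the structure $\mathbf{B}_w$ with universe $\{1,\dots,n\}$, $<$ the usual order, $S=\{i: w_i=1\}$, $\mathsf{min}=1$, $\mathsf{max}=n$. The number of quantifiers is the number of quantifier occurrences. *)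

theory Defs
  imports Complex_Main
begin

text \<open>First-order logic over the vocabulary (<, S; min, max) of binary strings.
  A string w_1...w_n in {0,1}^n is a list of booleans (True = 1); position i
  (1-based) of the structure B_w corresponds to list index i - 1.\<close>

datatype fterm = Var nat | MinC | MaxC

datatype fo =
    Less fterm fterm
  | Equal fterm fterm
  | Spred fterm
  | Neg fo
  | Conj fo fo
  | Disj fo fo
  | Ex nat fo
  | All nat fo

fun tvars :: "fterm \<Rightarrow> nat set" where
  "tvars (Var x) = {x}"
| "tvars MinC = {}"
| "tvars MaxC = {}"

fun fv :: "fo \<Rightarrow> nat set" where
  "fv (Less s t) = tvars s \<union> tvars t"
| "fv (Equal s t) = tvars s \<union> tvars t"
| "fv (Spred t) = tvars t"
| "fv (Neg \<phi>) = fv \<phi>"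
| "fv (Conj \<phi> \<psi>) = fv \<phi> \<union> fv \<psi>"
| "fv (Disj \<phi> \<psi>) = fv \<phi> \<union> fv \<psi>"
| "fv (Ex x \<phi>) = fv \<phi> - {x}"
| "fv (All x \<phi>) = fv \<phi> - {x}"

definition sentence :: "fo \<Rightarrow> bool" where
  "sentence \<phi> \<longleftrightarrow> fv \<phi> = {}"

fun qcount :: "fo \<Rightarrow> nat" where
  "qcount (Less s t) = 0"
| "qcount (Equal s t) = 0"
| "qcount (Spred t) = 0"
| "qcount (Neg \<phi>) = qcount \<phi>"
| "qcount (Conj \<phi> \<psi>) = qcount \<phi> + qcount \<psi>"
| "qcount (Disj \<phi> \<psi>) = qcount \<phi> + qcount \<psi>"
| "qcount (Ex x \<phi>) = Suc (qcount \<phi>)"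
| "qcount (All x \<phi>) = Suc (qcount \<phi>)"

fun teval :: "bool list \<Rightarrow> (nat \<Rightarrow> nat) \<Rightarrow> fterm \<Rightarrow> nat" where
  "teval w v (Var x) = v x"
| "teval w v MinC = 1"
| "teval w v MaxC = length w"

fun holds :: "bool list \<Rightarrow> (nat \<Rightarrow> nat) \<Rightarrow> fo \<Rightarrow> bool" where
  "holds w v (Less s t) \<longleftrightarrow> teval w v s < teval w v t"
| "holds w v (Equal s t) \<longleftrightarrow> teval w v s = teval w v t"
| "holds w v (Spred t) \<longleftrightarrow> (let i = teval w v t in 1 \<le> i \<and> i \<le> length w \<and> w ! (i - 1))"
| "holds w v (Neg \<phi>) \<longleftrightarrow> \<not> holds w v \<phi>"
| "holds w v (Conj \<phi> \<psi>) \<longleftrightarrow> holds w v \<phi> \<and> holds w v \<psi>"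
| "holds w v (Disj \<phi> \<psi>) \<longleftrightarrow> holds w v \<phi> \<or> holds w v \<psi>"
| "holds w v (Ex x \<phi>) \<longleftrightarrow> (\<exists>i\<in>{1..length w}. holds w (v(x := i)) \<phi>)"
| "holds w v (All x \<phi>) \<longleftrightarrow> (\<forall>i\<in>{1..length w}. holds w (v(x := i)) \<phi>)"

text \<open>B_w |= phi (for sentences, independent of the assignment).\<close>
definition models :: "bool list \<Rightarrow> fo \<Rightarrow> bool" where
  "models w \<phi> \<longleftrightarrow> (\<forall>v. (\<forall>x. v x \<in> {1..length w}) \<longrightarrow> holds w v \<phi>)"

definition tpar :: "nat \<Rightarrow> nat" where
  "tpar N = (if \<exists>t'::nat. t' \<ge> 2 \<and> real t' powr (exp 1 * real t') \<le> real N
             then (GREATEST t'::nat. t' \<ge> 2 \<and> real t' powr (exp 1 * real t') \<le> real N)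
             else 2)"

end

theory Submission
  imports Defs "HOL-Combinatorics.Multiset_Permutations"
begin

text \<open>If \<open>N \<le> k!\<close>, then \<open>k\<close> universal quantifiers choose points whose order type names the string
  to be refuted, and \<open>k = \<lceil>e (t + 1)\<rceil>\<close> is enough because \<open>k! \<ge> (k / e)\<^sup>k\<close>. For each string it remains
  to inspect one position where it differs from \<open>w\<close>. An alternating quantifier prefix that does not
  depend on the position does this, each quantifier halving a distance: \<open>\<exists>u\<close> splits an interval into
  two parts that must both be short, and \<open>\<forall>u\<close> challenges both parts simultaneously, since the place
  of \<open>u\<close> tells which part is meant. As the prefix is shared by all order types, it is counted once.
  If \<open>n \<le> k\<close>, then \<open>n\<close> quantifiers spell out the whole string.\<close>

section \<open>Prefix classes\<close>

text \<open>The quantifiers bind the consecutive variables from \<open>k\<close> on, so matrices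
  under the same prefix can be combined without renaming.\<close>

fun prenex :: "nat \<Rightarrow> bool list \<Rightarrow> fo \<Rightarrow> fo" where
  "prenex k [] M = M"
| "prenex k (b # q) M = (if b then Ex else All) k (prenex (Suc k) q M)"

lemma qcount_prenex: "qcount (prenex k q M) = length q + qcount M"
  by (induction q arbitrary: k) auto

lemma fv_prenex: "fv (prenex k q M) \<subseteq> fv M - {k..<k + length q}"
  by (induction q arbitrary: k) (fastforce split: if_splits)+

lemma teval_cong: "(\<And>x. x \<in> tvars t \<Longrightarrow> v x = v' x) \<Longrightarrow> teval w v t = teval w v' t"
  by (cases t) auto

lemma holds_cong: "(\<And>x. x \<in> fv \<phi> \<Longrightarrow> v x = v' x) \<Longrightarrow> holds w v \<phi> = holds w v' \<phi>"
proof (induction \<phi> arbitrary: v v')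
  case (Less s t)
  then show ?case using teval_cong[of s v v' w] teval_cong[of t v v' w] by simp
next
  case (Equal s t)
  then show ?case using teval_cong[of s v v' w] teval_cong[of t v v' w] by simp
next
  case (Spred t)
  then show ?case using teval_cong[of t v v' w] by simp
next
  case (Neg \<phi>)
  then show ?case by (metis fv.simps(4) holds.simps(4))
next
  case (Conj \<phi> \<psi>)
  then show ?case by (metis UnCI fv.simps(5) holds.simps(5))
next
  case (Disj \<phi> \<psi>)
  then show ?case by (metis UnCI fv.simps(6) holds.simps(6))
next
  case (Ex x \<phi>)
  have "holds w (v(x := i)) \<phi> = holds w (v'(x := i)) \<phi>" for i
    by (rule Ex.IH) (use Ex.prems in auto)
  then show ?case by simp
next
  case (All x \<phi>)
  have "holds w (v(x := i)) \<phi> = holds w (v'(x := i)) \<phi>" for i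
    by (rule All.IH) (use All.prems in auto)
  then show ?case by simp
qed

lemma teval_upd [simp]: "tvars t \<subseteq> {..<k} \<Longrightarrow> teval w (v(k := i)) t = teval w v t"
  by (rule teval_cong) auto

lemma holds_upd [simp]: "fv \<phi> \<subseteq> {..<k} \<Longrightarrow> holds w (v(k := i)) \<phi> = holds w v \<phi>"
  by (rule holds_cong) auto

definition valid :: "nat \<Rightarrow> bool list \<Rightarrow> (nat \<Rightarrow> nat) \<Rightarrow> bool" where
  "valid n w v \<longleftrightarrow> length w = n \<and> (\<forall>x. v x \<in> {1..n})"

lemma valid_upd: "valid n w v \<Longrightarrow> i \<in> {1..n} \<Longrightarrow> valid n w (v(k := i))"
  by (auto simp: valid_def)

lemma valid_teval: "valid n w v \<Longrightarrow> 1 \<le> teval w v t \<and> teval w v t \<le> n"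
  by (cases t) (auto simp: valid_def dest: spec[of _ 0])

text \<open>Strings have a fixed length \<open>n\<close>; the variables below \<open>k\<close> are free and \<open>q\<close> is the
  quantifier prefix, \<open>True\<close> standing for an existential quantifier.\<close>
definition definable :: "nat \<Rightarrow> nat \<Rightarrow> bool list \<Rightarrow> (bool list \<Rightarrow> (nat \<Rightarrow> nat) \<Rightarrow> bool) \<Rightarrow> bool" where
  "definable n k q P \<longleftrightarrow> (\<exists>M. qcount M = 0 \<and> fv M \<subseteq> {..<k + length q} \<and>
     (\<forall>w v. valid n w v \<longrightarrow> holds w v (prenex k q M) = P w v))"

lemma definable_cong:
  assumes "definable n k q P" "\<And>w v. valid n w v \<Longrightarrow> P w v = P' w v"
  shows "definable n k q P'"
  using assms unfolding definable_def by metis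

text \<open>Vacuous quantifiers do not change a truth value because validity forces a nonempty
  universe. This pads a constant to any prescribed prefix.\<close>

lemma holds_prenex_const:
  assumes "valid n w v"
  shows "holds w v (prenex k q (if b then Equal MinC MinC else Neg (Equal MinC MinC))) = b"
  using assms
proof (induction q arbitrary: k v)
  case (Cons c q)
  have "1 \<in> {1..n}" and "length w = n"
    using Cons.prems by (auto simp: valid_def dest: spec[of _ 0])
  moreover have "holds w (v(k := i))
      (prenex (Suc k) q (if b then Equal MinC MinC else Neg (Equal MinC MinC))) = b"
    if "i \<in> {1..n}" for i
    by (rule Cons.IH[OF valid_upd[OF Cons.prems that]])
  ultimately show ?case
    by (cases c) (simp_all only: prenex.simps if_True if_False holds.simps, blast+)
qed auto

lemma definable_const: "definable n k q (\<lambda>w v. b)"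
  unfolding definable_def
  by (rule exI[of _ "if b then Equal MinC MinC else Neg (Equal MinC MinC)"])
    (auto simp: holds_prenex_const simp del: if_split)

lemma definable_qfree:
  "fv R \<subseteq> {..<k} \<Longrightarrow> qcount R = 0 \<Longrightarrow> definable n k [] (\<lambda>w v. holds w v R)"
  unfolding definable_def by auto

lemma definable_Ex:
  assumes "definable n (Suc k) q P"
  shows "definable n k (True # q) (\<lambda>w v. \<exists>i\<in>{1..n}. P w (v(k := i)))"
proof -
  obtain M where M: "qcount M = 0" "fv M \<subseteq> {..<Suc k + length q}"
    "\<And>w v. valid n w v \<Longrightarrow> holds w v (prenex (Suc k) q M) = P w v"
    using assms unfolding definable_def by blast
  have "holds w v (prenex k (True # q) M) = (\<exists>i\<in>{1..n}. P w (v(k := i)))" if "valid n w v" for w v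
    using M(3)[OF valid_upd[OF that]] that by (auto simp: valid_def)
  then show ?thesis using M(1,2) unfolding definable_def by auto
qed

lemma definable_All:
  assumes "definable n (Suc k) q P"
  shows "definable n k (False # q) (\<lambda>w v. \<forall>i\<in>{1..n}. P w (v(k := i)))"
proof -
  obtain M where M: "qcount M = 0" "fv M \<subseteq> {..<Suc k + length q}"
    "\<And>w v. valid n w v \<Longrightarrow> holds w v (prenex (Suc k) q M) = P w v"
    using assms unfolding definable_def by blast
  have "holds w v (prenex k (False # q) M) = (\<forall>i\<in>{1..n}. P w (v(k := i)))" if "valid n w v" for w v
    using M(3)[OF valid_upd[OF that]] that by (auto simp: valid_def)
  then show ?thesis using M(1,2) unfolding definable_def by auto
qed

text \<open>The truth value of \<open>R\<close> is settled before the prefix starts binding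
  variables, so it selects one of the two matrices for good.\<close>

lemma holds_prenex_cases:
  assumes "fv R \<subseteq> {..<k}"
  shows "holds w v (prenex k q (Disj (Conj R M) (Conj (Neg R) M'))) =
    (if holds w v R then holds w v (prenex k q M) else holds w v (prenex k q M'))"
  using assms
proof (induction q arbitrary: k v)
  case (Cons b q)
  have "fv R \<subseteq> {..<Suc k}" using Cons.prems by auto
  from Cons.IH[OF this] show ?case
    using holds_upd[OF Cons.prems]
    by (cases b; cases "holds w v R") (simp_all only: prenex.simps if_True if_False holds.simps)
qed auto

text \<open>Case distinctions on quantifier-free conditions cost no quantifiers: both cases share
  the prefix.\<close>
lemma definable_cases:
  assumes "fv R \<subseteq> {..<k}" "qcount R = 0" "definable n k q P" "definable n k q P'"
  shows "definable n k q (\<lambda>w v. if holds w v R then P w v else P' w v)"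
proof -
  obtain M where M: "qcount M = 0" "fv M \<subseteq> {..<k + length q}"
    "\<And>w v. valid n w v \<Longrightarrow> holds w v (prenex k q M) = P w v"
    using assms(3) unfolding definable_def by blast
  obtain M' where M': "qcount M' = 0" "fv M' \<subseteq> {..<k + length q}"
    "\<And>w v. valid n w v \<Longrightarrow> holds w v (prenex k q M') = P' w v"
    using assms(4) unfolding definable_def by blast
  show ?thesis unfolding definable_def
    by (rule exI[of _ "Disj (Conj R M) (Conj (Neg R) M')"])
      (use M M' assms(1,2) holds_prenex_cases[OF assms(1)] in auto)
qed

text \<open>At most one guard holds, so the conjunction collapses to a cascade of case distinctions.
  An arbitrary conjunction could not be moved under the shared existential quantifiers.\<close>

lemma definable_exclusive_conj:
  assumes "finite B"
    and "\<And>b. b \<in> B \<Longrightarrow> fv (R b) \<subseteq> {..<k} \<and> qcount (R b) = 0 \<and> definable n k q (P b)"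
    and "\<And>b b' w v. \<lbrakk>b \<in> B; b' \<in> B; b \<noteq> b'; holds w v (R b)\<rbrakk> \<Longrightarrow> \<not> holds w v (R b')"
  shows "definable n k q (\<lambda>w v. \<forall>b\<in>B. holds w v (R b) \<longrightarrow> P b w v)"
  using assms
proof (induction B)
  case empty
  show ?case using definable_const[of n k q True] by simp
next
  case (insert b B)
  have "definable n k q (\<lambda>w v. if holds w v (R b) then P b w v
      else \<forall>b\<in>B. holds w v (R b) \<longrightarrow> P b w v)"
  proof (rule definable_cases)
    show "definable n k q (\<lambda>w v. \<forall>b\<in>B. holds w v (R b) \<longrightarrow> P b w v)"
      by (rule insert.IH) (use insert.prems in \<open>blast+\<close>)
  qed (use insert.prems(1) in auto)
  then show ?case
    by (rule definable_cong) (use insert.prems(2) insert.hyps in fastforce)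
qed

lemma definable_All_block:
  assumes "definable n (j + k) q P"
  shows "definable n j (replicate k False @ q)
    (\<lambda>w v. \<forall>v'. valid n w v' \<and> (\<forall>x. x \<notin> {j..<j + k} \<longrightarrow> v' x = v x) \<longrightarrow> P w v')"
  using assms
proof (induction k arbitrary: j)
  case 0
  have "(\<forall>x. v' x = v x) \<longleftrightarrow> v' = v" for v v' :: "nat \<Rightarrow> nat" by auto
  with 0 show ?case by (auto intro: definable_cong)
next
  case (Suc k)
  let ?P = "\<lambda>w v. \<forall>v'. valid n w v' \<and> (\<forall>x. x \<notin> {Suc j..<Suc j + k} \<longrightarrow> v' x = v x) \<longrightarrow> P w v'"
  have "definable n j (False # replicate k False @ q) (\<lambda>w v. \<forall>i\<in>{1..n}. ?P w (v(j := i)))"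
    by (rule definable_All, rule Suc.IH) (use Suc.prems in simp)
  then have "definable n j (replicate (Suc k) False @ q) (\<lambda>w v. \<forall>i\<in>{1..n}. ?P w (v(j := i)))"
    by simp
  then show ?case
  proof (rule definable_cong)
    fix w v
    show "(\<forall>i\<in>{1..n}. ?P w (v(j := i))) \<longleftrightarrow>
      (\<forall>v'. valid n w v' \<and> (\<forall>x. x \<notin> {j..<j + Suc k} \<longrightarrow> v' x = v x) \<longrightarrow> P w v')"
      (is "?L \<longleftrightarrow> ?R")
    proof
      assume L: ?L
      show ?R
      proof (intro allI impI)
        fix v' assume v': "valid n w v' \<and> (\<forall>x. x \<notin> {j..<j + Suc k} \<longrightarrow> v' x = v x)"
        have "v' j \<in> {1..n}" using v' by (auto simp: valid_def)
        moreover have "\<forall>x. x \<notin> {Suc j..<Suc j + k} \<longrightarrow> v' x = (v(j := v' j)) x"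
          using v' by auto
        ultimately show "P w v'" using L v' by blast
      qed
    next
      assume ?R then show ?L by auto
    qed
  qed
qed

section \<open>Locating a position\<close>

fun alternating :: "bool \<Rightarrow> nat \<Rightarrow> bool list" where
  "alternating b 0 = []"
| "alternating b (Suc m) = b # alternating (\<not> b) m"

lemma length_alternating [simp]: "length (alternating b m) = m"
  by (induction m arbitrary: b) auto

text \<open>\<open>gap b\<close> for \<open>b = True\<close> is the disjunction and for \<open>b = False\<close> the conjunction.\<close>
definition gap :: "bool \<Rightarrow> nat \<Rightarrow> nat \<Rightarrow> nat \<Rightarrow> nat \<Rightarrow> nat \<Rightarrow> bool" where
  "gap b d d' s z t \<longleftrightarrow> s \<le> z \<and> z \<le> t \<and>
     (if b then z < s + d \<or> t < z + d' else z < s + d \<and> t < z + d')"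

text \<open>\<open>z < s + d\<close> holds iff some \<open>u\<close> between \<open>s\<close> and \<open>z\<close> is close to both, with the bounds
  adding up to \<open>d + 1\<close>. The witness for the first disjunct is taken below \<open>z\<close> and that for the
  second one from \<open>z\<close> on, so that the matrix can tell which disjunct is meant.\<close>
lemma gap_True_step:
  assumes "1 \<le> s" "t \<le> n"
  shows "gap True d d' s z t \<longleftrightarrow> (\<exists>u\<in>{1..n}. s \<le> z \<and> z \<le> t \<and>
    (if z = s \<and> d \<ge> 1 then True
     else if u < z then gap False ((d + 1) div 2) (d + 1 - (d + 1) div 2) s u z
     else gap False ((d' + 1) div 2) (d' + 1 - (d' + 1) div 2) z u t))"
    (is "?L \<longleftrightarrow> ?R")
proof
  assume L: ?L
  then have st: "s \<le> z" "z \<le> t" by (auto simp: gap_def)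
  show ?R
  proof (cases "z = s \<and> d \<ge> 1")
    case True
    then show ?thesis using st assms by (intro bexI[of _ s]) auto
  next
    case False
    show ?thesis
    proof (cases "z < s + d")
      case True
      \<comment> \<open>Here \<open>s < z < s + d\<close>, so \<open>d \<ge> 2\<close> and
        \<open>b \<ge> 2\<close>; this puts \<open>u\<close> strictly below \<open>z\<close>. It is
        the least point from \<open>s\<close> on with \<open>z < u + b\<close>.\<close>
      define b where "b = d + 1 - (d + 1) div 2"
      define u where "u = max s (z + 1 - b)"
      have "u < z" "s \<le> u" "u < s + (d + 1) div 2" "z < u + b"
        using False True st unfolding u_def b_def by (auto simp: max_def)
      then show ?thesis
        using st assms False by (intro bexI[of _ u]) (auto simp: gap_def b_def)
    next
      case F: False
      then have T: "t < z + d'" using L by (auto simp: gap_def)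
      define u where "u = min t (z + (d' + 1) div 2 - 1)"
      have "z \<le> u" "u \<le> t" "u < z + (d' + 1) div 2" "t < u + (d' + 1 - (d' + 1) div 2)"
        using T st unfolding u_def by (auto simp: min_def)
      then show ?thesis
        using st assms False by (intro bexI[of _ u]) (auto simp: gap_def)
    qed
  qed
next
  assume ?R
  then show ?L by (auto simp: gap_def split: if_splits)
qed

text \<open>If \<open>z \<ge> s + d\<close>, the challenge \<open>u = s + d div 2\<close> is too far
  from both \<open>s\<close> and \<open>z\<close>; here the two bounds add up to \<open>d\<close>,
  not \<open>d + 1\<close>. The right part is analogous. The condition \<open>d \<ge> 1\<close> is
  explicit because for \<open>z = s\<close> no \<open>u\<close> lies in the left part to detect
  \<open>d = 0\<close>.\<close>

lemma gap_False_step: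
  assumes "1 \<le> s" "t \<le> n" "1 \<le> n"
  shows "gap False d d' s z t \<longleftrightarrow> (\<forall>u\<in>{1..n}. s \<le> z \<and> z \<le> t \<and> d \<ge> 1 \<and>
    (if u < z then u < s \<or> gap True (d div 2) (d - d div 2) s u z
     else t < u \<or> gap True (d' div 2) (d' - d' div 2) z u t))"
    (is "?L \<longleftrightarrow> ?R")
proof
  assume L: ?L
  then show ?R by (auto simp: gap_def)
next
  assume R: ?R
  have st: "s \<le> z" "z \<le> t" "d \<ge> 1"
    using bspec[OF R, of 1] assms by auto
  have "z < s + d"
  proof (rule ccontr)
    assume "\<not> z < s + d"
    moreover from this have "s + d div 2 < z" "s + d div 2 \<in> {1..n}"
      using st assms by auto
    ultimately show False
      using st bspec[OF R, of "s + d div 2"] by (auto simp: gap_def)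
  qed
  moreover have "t < z + d'"
  proof (rule ccontr)
    assume "\<not> t < z + d'"
    moreover from this have "z + d' div 2 \<le> t" "z + d' div 2 \<in> {1..n}"
      using st assms by auto
    ultimately show False
      using st bspec[OF R, of "z + d' div 2"] by (auto simp: gap_def)
  qed
  ultimately show ?L using st by (auto simp: gap_def)
qed

section \<open>Distance conditions between terms in prefix classes\<close>

definition gap_rel ::
  "bool \<Rightarrow> nat \<Rightarrow> nat \<Rightarrow> fterm \<Rightarrow> fterm \<Rightarrow> fterm \<Rightarrow> bool list \<Rightarrow> (nat \<Rightarrow> nat) \<Rightarrow> bool" where
  "gap_rel b d d' s z t = (\<lambda>w v. gap b d d' (teval w v s) (teval w v z) (teval w v t))"

definition falsum :: fo where
  "falsum = Neg (Equal MinC MinC)"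

lemma falsum_simps [simp]: "\<not> holds w v falsum" "fv falsum = {}" "qcount falsum = 0"
  by (auto simp: falsum_def)

definition between :: "fterm \<Rightarrow> fterm \<Rightarrow> fterm \<Rightarrow> fo" where
  "between s z t = Conj (Neg (Less z s)) (Neg (Less t z))"

lemma between_simps [simp]:
  "holds w v (between s z t) \<longleftrightarrow> teval w v s \<le> teval w v z \<and> teval w v z \<le> teval w v t"
  "fv (between s z t) = tvars s \<union> tvars z \<union> tvars t"
  "qcount (between s z t) = 0"
  by (auto simp: between_def)

text \<open>Without quantifiers only equality can be tested: for \<open>s \<le> z\<close>,
  \<open>z < s + 1\<close> means \<open>z = s\<close>, and \<open>z < s + 0\<close> is
  false.\<close>

lemma definable_gap_base:
  assumes "tvars s \<union> tvars z \<union> tvars t \<subseteq> {..<k}" "d \<le> 1" "d' \<le> 1"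
  shows "definable n k [] (gap_rel b d d' s z t)"
proof -
  let ?eq = "\<lambda>d x y. if d = (1::nat) then Equal x y else falsum"
  have "definable n k [] (\<lambda>w v. holds w v (Conj (between s z t)
      ((if b then Disj else Conj) (?eq d z s) (?eq d' t z))))"
    by (rule definable_qfree) (use assms in auto)
  then show ?thesis
  proof (rule definable_cong)
    show "holds w v (Conj (between s z t) ((if b then Disj else Conj) (?eq d z s) (?eq d' t z)))
      = gap_rel b d d' s z t w v" for w v
      using assms by (auto simp: gap_rel_def gap_def le_Suc_eq)
  qed
qed

text \<open>The two parts of \<open>d\<close> add up to \<open>d + 1\<close>, so both are at most
  \<open>c\<close> when \<open>d \<le> 2 * c - 1\<close>. Comparing \<open>u\<close> with
  \<open>z\<close> is quantifier-free, so the two subproblems share \<open>q\<close>.\<close>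

lemma definable_gap_True_step:
  assumes IH: "\<And>s z t d d'. \<lbrakk>tvars s \<union> tvars z \<union> tvars t \<subseteq> {..<Suc k}; d \<le> c; d' \<le> c\<rbrakk> \<Longrightarrow>
      definable n (Suc k) q (gap_rel False d d' s z t)"
    and vars: "tvars s \<union> tvars z \<union> tvars t \<subseteq> {..<k}" and "d \<le> 2 * c - 1" "d' \<le> 2 * c - 1" "c \<ge> 1"
  shows "definable n k (True # q) (gap_rel True d d' s z t)"
proof -
  let ?h = "\<lambda>d. (d + 1) div 2"
  let ?eq = "if d \<ge> 1 then Equal z s else falsum"
  let ?g1 = "gap_rel False (?h d) (d + 1 - ?h d) s (Var k) z"
  let ?g2 = "gap_rel False (?h d') (d' + 1 - ?h d') z (Var k) t"
  let ?P = "\<lambda>w v. if holds w v (between s z t) then if holds w v ?eq then True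
      else if holds w v (Less (Var k) z) then ?g1 w v else ?g2 w v else False"
  have vars': "tvars s \<subseteq> {..<Suc k}" "tvars z \<subseteq> {..<Suc k}" "tvars t \<subseteq> {..<Suc k}"
    using vars by auto
  have "definable n (Suc k) q ?g1" "definable n (Suc k) q ?g2"
    by (rule IH; use vars' assms(3-) in auto)+
  then have "definable n (Suc k) q ?P"
    by (intro definable_cases definable_const) (use vars' in auto)
  from definable_Ex[OF this] show ?thesis
  proof (rule definable_cong)
    fix w v assume v: "valid n w v"
    let ?s = "teval w v s" and ?z = "teval w v z" and ?t = "teval w v t"
    have "?P w (v(k := i)) \<longleftrightarrow> ?s \<le> ?z \<and> ?z \<le> ?t \<and>
      (if ?z = ?s \<and> d \<ge> 1 then True
       else if i < ?z then gap False (?h d) (d + 1 - ?h d) ?s i ?z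
       else gap False (?h d') (d' + 1 - ?h d') ?z i ?t)" for i
      using vars by (simp add: gap_rel_def) blast
    then show "(\<exists>i\<in>{1..n}. ?P w (v(k := i))) = gap_rel True d d' s z t w v"
      using gap_True_step[of ?s ?t n d d' ?z] valid_teval[OF v, of s] valid_teval[OF v, of t]
      by (simp only: gap_rel_def)
  qed
qed

lemma definable_gap_False_step:
  assumes IH: "\<And>s z t d d'. \<lbrakk>tvars s \<union> tvars z \<union> tvars t \<subseteq> {..<Suc k}; d \<le> c; d' \<le> c\<rbrakk> \<Longrightarrow>
      definable n (Suc k) q (gap_rel True d d' s z t)"
    and vars: "tvars s \<union> tvars z \<union> tvars t \<subseteq> {..<k}" and "d \<le> 2 * c" "d' \<le> 2 * c"
  shows "definable n k (False # q) (gap_rel False d d' s z t)"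
proof -
  let ?pos = "if d \<ge> 1 then between s z t else falsum"
  let ?g1 = "gap_rel True (d div 2) (d - d div 2) s (Var k) z"
  let ?g2 = "gap_rel True (d' div 2) (d' - d' div 2) z (Var k) t"
  let ?P = "\<lambda>w v. if holds w v ?pos then
      if holds w v (Less (Var k) z) then if holds w v (Less (Var k) s) then True else ?g1 w v
      else if holds w v (Less t (Var k)) then True else ?g2 w v else False"
  have vars': "tvars s \<subseteq> {..<Suc k}" "tvars z \<subseteq> {..<Suc k}" "tvars t \<subseteq> {..<Suc k}"
    using vars by auto
  have "definable n (Suc k) q ?g1" "definable n (Suc k) q ?g2"
    by (rule IH; use vars' assms(3-) in auto)+
  then have "definable n (Suc k) q ?P"
    by (intro definable_cases definable_const) (use vars' in auto)
  from definable_All[OF this] show ?thesis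
  proof (rule definable_cong)
    fix w v assume v: "valid n w v"
    let ?s = "teval w v s" and ?z = "teval w v z" and ?t = "teval w v t"
    have "?P w (v(k := i)) \<longleftrightarrow> ?s \<le> ?z \<and> ?z \<le> ?t \<and> d \<ge> 1 \<and>
      (if i < ?z then i < ?s \<or> gap True (d div 2) (d - d div 2) ?s i ?z
       else ?t < i \<or> gap True (d' div 2) (d' - d' div 2) ?z i ?t)" for i
      using vars by (simp add: gap_rel_def) blast
    moreover have "1 \<le> n" using valid_teval[OF v, of s] by linarith
    ultimately show "(\<forall>i\<in>{1..n}. ?P w (v(k := i))) = gap_rel False d d' s z t w v"
      using gap_False_step[of ?s ?t n d d' ?z] valid_teval[OF v, of s] valid_teval[OF v, of t]
      by (simp only: gap_rel_def)
  qed
qed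

text \<open>Every quantifier doubles the distances that can be measured, up to rounding.\<close>
lemma definable_gap:
  "\<exists>c c'. 2 ^ m + 1 \<le> 3 * c \<and> 2 ^ m + 2 \<le> 3 * c' \<and>
    (\<forall>k s z t d d'. tvars s \<union> tvars z \<union> tvars t \<subseteq> {..<k} \<longrightarrow>
      (d \<le> c \<and> d' \<le> c \<longrightarrow> definable n k (alternating True m) (gap_rel True d d' s z t)) \<and>
      (d \<le> c' \<and> d' \<le> c' \<longrightarrow> definable n k (alternating False m) (gap_rel False d d' s z t)))"
proof (induction m)
  case 0
  show ?case
    by (rule exI[of _ 1], rule exI[of _ 1]) (auto intro: definable_gap_base)
next
  case (Suc m)
  then obtain c c' where c: "2 ^ m + 1 \<le> 3 * c" "2 ^ m + 2 \<le> 3 * c'"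
    and T: "\<And>k s z t d d'. \<lbrakk>tvars s \<union> tvars z \<union> tvars t \<subseteq> {..<k}; d \<le> c; d' \<le> c\<rbrakk> \<Longrightarrow>
      definable n k (alternating True m) (gap_rel True d d' s z t)"
    and F: "\<And>k s z t d d'. \<lbrakk>tvars s \<union> tvars z \<union> tvars t \<subseteq> {..<k}; d \<le> c'; d' \<le> c'\<rbrakk> \<Longrightarrow>
      definable n k (alternating False m) (gap_rel False d d' s z t)"
    by blast
  \<comment> \<open>The bounds are reproduced: \<open>3 * (2 * c' - 1)\<close> is at least
    \<open>2 * (2 ^ m + 2) - 3 = 2 ^ Suc m + 1\<close>, and \<open>3 * (2 * c)\<close> is at least
    \<open>2 ^ Suc m + 2\<close>.\<close>
  have "c' \<ge> 1" using c by simp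
  then show ?case
    using c definable_gap_True_step[OF F] definable_gap_False_step[OF T]
    by (intro exI[of _ "2 * c' - 1"] exI[of _ "2 * c"]) simp
qed

text \<open>Bounding the distance from both ends pins the chosen point to \<open>i + 1\<close>, the
  position of list index \<open>i\<close>. Both bounds are at most \<open>n\<close>, which is within
  reach once \<open>3 * n \<le> 2 ^ m\<close>. The prefix does not depend on
  \<open>i\<close>.\<close>

lemma definable_letter:
  assumes "i < n" "3 * n \<le> 2 ^ m"
  shows "definable n k (True # alternating False m) (\<lambda>w v. w ! i = b)"
proof -
  let ?g = "gap_rel False (i + 1) (n - i) MinC (Var k) MaxC"
  let ?S = "if b then Spred (Var k) else Neg (Spred (Var k))"
  have "definable n (Suc k) (alternating False m) ?g"
  proof -
    obtain c where "2 ^ m + 2 \<le> 3 * c" and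
      "\<And>k s z t d d'. \<lbrakk>tvars s \<union> tvars z \<union> tvars t \<subseteq> {..<k}; d \<le> c; d' \<le> c\<rbrakk> \<Longrightarrow>
        definable n k (alternating False m) (gap_rel False d d' s z t)"
      using definable_gap[of m n] by blast
    then show ?thesis using assms by simp
  qed
  then have "definable n (Suc k) (alternating False m)
      (\<lambda>w v. if holds w v ?S then ?g w v else False)"
    by (intro definable_cases definable_const) auto
  from definable_Ex[OF this] show ?thesis
  proof (rule definable_cong)
    fix w v assume "valid n w v"
    then have n: "length w = n" by (simp add: valid_def)
    have "?g w (v(k := j)) \<longleftrightarrow> j = i + 1" if "j \<in> {1..n}" for j
      using that assms(1) n by (auto simp: gap_rel_def gap_def)
    moreover have "holds w (v(k := j)) ?S \<longleftrightarrow> w ! (j - 1) = b" if "j \<in> {1..n}" for j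
      using that n by auto
    ultimately show "(\<exists>j\<in>{1..n}. if holds w (v(k := j)) ?S then ?g w (v(k := j)) else False)
      = (w ! i = b)"
      using assms(1) by auto
  qed
qed

section \<open>Order types\<close>

fun chain :: "nat list \<Rightarrow> fo" where
  "chain (x # y # xs) = Conj (Less (Var x) (Var y)) (chain (y # xs))"
| "chain xs = Equal MinC MinC"

lemma holds_chain: "holds w v (chain xs) \<longleftrightarrow> sorted_wrt (<) (map v xs)"
proof (induction xs rule: chain.induct)
  case (1 x y xs)
  have "transp ((<) :: nat \<Rightarrow> nat \<Rightarrow> bool)" by simp
  then show ?case using 1 by (simp add: sorted_wrt2 del: sorted_wrt.simps)
qed auto

lemma fv_chain: "fv (chain xs) \<subseteq> set xs"
  by (induction xs rule: chain.induct) auto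

lemma qcount_chain [simp]: "qcount (chain xs) = 0"
  by (induction xs rule: chain.induct) auto

text \<open>Both images enumerate the same values increasingly, and \<open>v\<close> is injective.
  Hence different order types are mutually exclusive guards.\<close>

lemma sorted_map_unique:
  fixes v :: "'a \<Rightarrow> 'b :: linorder"
  assumes "set xs = set ys" "sorted_wrt (<) (map v xs)" "sorted_wrt (<) (map v ys)"
  shows "xs = ys"
proof -
  have "map v xs = map v ys"
    using assms by (intro sorted_distinct_set_unique) (auto simp: strict_sorted_iff)
  moreover have "inj_on v (set xs \<union> set ys)"
    using assms by (simp add: strict_sorted_iff distinct_map)
  ultimately show ?thesis by (rule map_inj_on)
qed

section \<open>Separating a string from a set of strings\<close>

definition separable :: "bool list \<Rightarrow> bool list set \<Rightarrow> nat \<Rightarrow> bool" where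
  "separable w B r \<longleftrightarrow>
     (\<exists>\<phi>. sentence \<phi> \<and> qcount \<phi> \<le> r \<and> models w \<phi> \<and> (\<forall>w'\<in>B. \<not> models w' \<phi>))"

lemma separable_if_definable:
  assumes "definable n 0 q P" "length w = n" "\<And>v. valid n w v \<Longrightarrow> P w v"
    and "\<And>w'. w' \<in> B \<Longrightarrow> \<exists>v. valid n w' v \<and> \<not> P w' v"
  shows "separable w B (length q)"
proof -
  obtain M where M: "qcount M = 0" "fv M \<subseteq> {..<length q}"
    "\<And>w v. valid n w v \<Longrightarrow> holds w v (prenex 0 q M) = P w v"
    using assms(1) unfolding definable_def by auto
  show ?thesis unfolding separable_def
  proof (intro exI[of _ "prenex 0 q M"] conjI ballI)
    show "sentence (prenex 0 q M)"
      using fv_prenex[of 0 q M] M(2) by (fastforce simp: sentence_def)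
    show "qcount (prenex 0 q M) \<le> length q"
      using M(1) by (simp add: qcount_prenex)
    show "models w (prenex 0 q M)"
      using assms(2,3) M(3) by (auto simp: models_def valid_def)
    show "\<not> models w' (prenex 0 q M)" if "w' \<in> B" for w'
      using assms(4)[OF that] M(3) by (auto simp: models_def valid_def)
  qed
qed

text \<open>An increasing sequence of \<open>n\<close> points in an \<open>n\<close>-element
  universe must be the list of all positions, so each variable names a known letter.\<close>

lemma separable_short:
  assumes "length w = n" "n \<ge> 1" "\<And>w'. w' \<in> B \<Longrightarrow> length w' = n \<and> w' \<noteq> w"
  shows "separable w B n"
proof -
  let ?S = "\<lambda>i. if w ! i then Spred (Var i) else Neg (Spred (Var i))"
  let ?M = "\<lambda>w' v. \<forall>i<n. holds w' v (chain [0..<n]) \<longrightarrow> holds w' v (?S i)"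
  have pos: "v i = i + 1" if v: "valid n w' v" "holds w' v (chain [0..<n])" "i < n" for w' v i
  proof -
    have sd: "sorted (map v [0..<n])" "distinct (map v [0..<n])"
      using v(2) by (auto simp: holds_chain strict_sorted_iff)
    have "set (map v [0..<n]) = {1..n}"
      using v(1) sd(2) by (intro card_subset_eq) (auto simp: valid_def distinct_map card_image)
    then have "map v [0..<n] = [1..<n + 1]"
      using sd by (intro sorted_distinct_set_unique) (auto simp del: upt_Suc)
    then have "map v [0..<n] ! i = [1..<n + 1] ! i" by simp
    then show ?thesis using v(3) by (simp del: upt_Suc)
  qed
  have "definable n n [] (\<lambda>w' v. \<forall>i<m. holds w' v (chain [0..<n]) \<longrightarrow> holds w' v (?S i))"
    if "m \<le> n" for m
    using that
  proof (induction m)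
    case 0
    show ?case using definable_const[of n n "[]" True] by simp
  next
    case (Suc m)
    have "definable n n [] (\<lambda>w' v. if holds w' v (Disj (Neg (chain [0..<n])) (?S m)) then
        \<forall>i<m. holds w' v (chain [0..<n]) \<longrightarrow> holds w' v (?S i) else False)"
      by (intro definable_cases definable_const Suc.IH)
        (use Suc.prems fv_chain[of "[0..<n]"] in auto)
    then show ?case by (rule definable_cong) (auto simp: less_Suc_eq)
  qed
  then have "definable n (0 + n) [] ?M" by simp
  from definable_All_block[OF this] have "separable w B (length (replicate n False @ []))"
  proof (rule separable_if_definable)
    show "length w = n" by fact
  next
    fix v
    show "\<forall>v'. valid n w v' \<and> (\<forall>x. x \<notin> {0..<0 + n} \<longrightarrow> v' x = v x) \<longrightarrow> ?M w v'"
    proof (intro allI impI, elim conjE)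
      fix v' i assume "valid n w v'" "i < n" "holds w v' (chain [0..<n])"
      then have "v' i = i + 1" by (intro pos)
      then show "holds w v' (?S i)" using \<open>i < n\<close> assms(1) by simp
    qed
  next
    fix w' assume w': "w' \<in> B"
    then obtain i where i: "i < n" "w' ! i \<noteq> w ! i"
      using assms(1) assms(3)[OF w'] nth_equalityI[of w' w] by metis
    \<comment> \<open>The value 1 elsewhere only keeps the assignment inside the universe.\<close>
    define v where "v x = (if x < n then x + 1 else 1)" for x
    have v: "valid n w' v" using assms(2,3) w' by (auto simp: valid_def v_def)
    have "map v [0..<n] = [1..<n + 1]"
      by (rule nth_equalityI) (auto simp: v_def simp del: upt_Suc)
    then have "holds w' v (chain [0..<n])"
      unfolding holds_chain by (simp only: sorted_wrt_upt)
    moreover have "\<not> holds w' v (?S i)"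
      using i assms(3)[OF w'] by (auto simp: v_def)
    ultimately show "\<exists>v. valid n w' v \<and>
      \<not> (\<forall>v'. valid n w' v' \<and> (\<forall>x. x \<notin> {0..<0 + n} \<longrightarrow> v' x = v x) \<longrightarrow> ?M w' v')"
      using i(1) v by blast
  qed
  then show ?thesis by simp
qed

text \<open>The order type of \<open>k\<close> universally chosen points selects which of the at most \<open>k!\<close> strings
  is to be refuted; all strings then share the prefix that locates a position.\<close>
lemma separable_long:
  assumes "length w = n" "n \<ge> 1" "k \<le> n" "3 * n \<le> 2 ^ m"
    and B: "\<And>w'. w' \<in> B \<Longrightarrow> length w' = n \<and> w' \<noteq> w" and "finite B" "card B \<le> fact k"
  shows "separable w B (k + (m + 1))"
proof -
  let ?perms = "permutations_of_set {0..<k}"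
  have "card B \<le> card ?perms" using assms(7) by simp
  \<comment> \<open>Each string to be refuted receives a permutation of its own as order
    type.\<close>
  then obtain g where g: "g ` B \<subseteq> ?perms" "inj_on g B"
    using card_le_inj[of B ?perms] assms(6) by auto
  have "\<exists>i<n. w' ! i \<noteq> w ! i" if "w' \<in> B" for w'
    using B[OF that] assms(1) nth_equalityI[of w' w] by metis
  then obtain p where p: "\<And>w'. w' \<in> B \<Longrightarrow> p w' < n \<and> w' ! p w' \<noteq> w ! p w'"
    by metis
  have set_g: "set (g b) = {0..<k}" "distinct (g b)" if "b \<in> B" for b
    using g(1) that by (auto simp: permutations_of_set_def)
  let ?q = "True # alternating False m"
  let ?M = "\<lambda>w' v. \<forall>b\<in>B. holds w' v (chain (g b)) \<longrightarrow> w' ! p b = w ! p b"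
  have "definable n k ?q ?M"
  proof (rule definable_exclusive_conj)
    show "finite B" by fact
    show "fv (chain (g b)) \<subseteq> {..<k} \<and> qcount (chain (g b)) = 0 \<and>
        definable n k ?q (\<lambda>w' v. w' ! p b = w ! p b)" if "b \<in> B" for b
      using definable_letter[OF _ assms(4), of "p b"] p[OF that] fv_chain[of "g b"] set_g[OF that]
      by auto
    show "\<not> holds w' v (chain (g b'))"
      if "b \<in> B" "b' \<in> B" "b \<noteq> b'" "holds w' v (chain (g b))" for b b' w' v
      using that sorted_map_unique[of "g b" "g b'" v] set_g inj_onD[OF g(2)]
      unfolding holds_chain by metis
  qed
  then have "definable n (0 + k) ?q ?M" by simp
  from definable_All_block[OF this]
  have "separable w B (length (replicate k False @ ?q))"
  proof (rule separable_if_definable)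
    show "length w = n" by fact
  next
    fix v
    show "\<forall>v'. valid n w v' \<and> (\<forall>x. x \<notin> {0..<0 + k} \<longrightarrow> v' x = v x) \<longrightarrow> ?M w v'" by simp
  next
    fix w' assume w': "w' \<in> B"
    let ?xs = "g w'"
    have len: "length ?xs = k" using set_g[OF w'] by (metis card_atLeastLessThan diff_zero distinct_card)
    \<comment> \<open>\<open>pos\<close> inverts the permutation, so \<open>v\<close> takes the
      values \<open>1, ..., k\<close> along \<open>g w'\<close>; \<open>k \<le> n\<close> keeps them
      in the universe.\<close>
    define pos where "pos x = (THE j. j < k \<and> ?xs ! j = x)" for x
    have pos: "pos (?xs ! j) = j" if "j < k" for j
      unfolding pos_def using that len set_g[OF w'] by (auto simp: nth_eq_iff_index_eq)
    define v where "v x = (if x < k then pos x + 1 else 1)" for x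
    have nth_k: "?xs ! j < k" if "j < k" for j
      using nth_mem[of j ?xs] that unfolding len set_g(1)[OF w'] by simp
    have "map v ?xs = [1..<k + 1]"
      by (rule nth_equalityI) (use len pos nth_k in \<open>auto simp: v_def simp del: upt_Suc\<close>)
    then have "holds w' v (chain ?xs)"
      unfolding holds_chain by (simp only: sorted_wrt_upt)
    moreover have "valid n w' v"
    proof -
      have "pos x < k" if x: "x < k" for x
      proof -
        obtain j where "j < k" "?xs ! j = x"
          using x in_set_conv_nth[of x ?xs] unfolding len set_g(1)[OF w'] by auto
        then show ?thesis using pos by auto
      qed
      then show ?thesis
        using B[OF w'] assms(2,3) by (force simp: valid_def v_def Suc_le_eq)
    qed
    ultimately show "\<exists>v. valid n w' v \<and>
      \<not> (\<forall>v'. valid n w' v' \<and> (\<forall>x. x \<notin> {0..<0 + k} \<longrightarrow> v' x = v x) \<longrightarrow> ?M w' v')"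
      using p[OF w'] w' by blast
  qed
  then show ?thesis by simp
qed

section \<open>Counting quantifiers\<close>

text \<open>\<open>k ^ k / k!\<close> is a single term of the exponential series for
  \<open>exp k\<close>, whose terms are all nonnegative.\<close>

lemma power_self_le_fact_exp: "real k ^ k \<le> fact k * exp (real k)"
proof -
  have "(\<Sum>i\<in>{k}. real k ^ i /\<^sub>R fact i) \<le> (\<Sum>i. real k ^ i /\<^sub>R fact i)"
    by (rule sum_le_suminf) (use summable_exp_generic[of "real k"] in auto)
  then have "real k ^ k / fact k \<le> exp (real k)"
    by (simp add: exp_def field_simps)
  then show ?thesis by (simp add: field_simps)
qed

text \<open>Since \<open>x \<le> k / e\<close>, the left side is at most \<open>x ^ k\<close>, hence
  at most \<open>(k / e) ^ k\<close>, which is below \<open>k!\<close>.\<close>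

lemma powr_le_fact:
  assumes "1 \<le> x" "exp 1 * x \<le> real k"
  shows "x powr (exp 1 * x) \<le> fact k"
proof -
  have "x powr (exp 1 * x) \<le> x powr real k"
    using assms by (intro powr_mono) auto
  also have "\<dots> = x ^ k" using assms by (simp add: powr_realpow)
  also have "\<dots> \<le> (real k / exp 1) ^ k"
    using assms by (intro power_mono) (auto simp: field_simps)
  also have "\<dots> = real k ^ k / exp (real k)"
    by (simp add: power_divide exp_of_nat_mult[symmetric])
  also have "\<dots> \<le> fact k"
    using power_self_le_fact_exp[of k] by (simp add: field_simps)
  finally show ?thesis .
qed

text \<open>Maximality of \<open>t\<close> gives \<open>N < (t + 1) powr (e * (t + 1))\<close>,
  which is at most \<open>k!\<close> for \<open>k\<close> the ceiling of \<open>e * (t + 1)\<close>.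
  Moreover \<open>e * t\<close> is at most the logarithm of \<open>N\<close> to base
  \<open>t\<close>, so only a constant is lost.\<close>

lemma le_fact_tpar:
  assumes "N \<ge> 1"
  shows "\<exists>k. N \<le> fact k \<and> real k \<le> log (real (tpar N)) (real N) + 9"
proof -
  let ?P = "\<lambda>t::nat. t \<ge> 2 \<and> real t powr (exp 1 * real t) \<le> real N"
  have e: "2 \<le> exp (1::real)" "exp (1::real) \<le> 3"
    using exp_ge_add_one_self[of 1] exp_le by auto
  show ?thesis
  proof (cases "\<exists>t. ?P t")
    case True
    \<comment> \<open>Admissible values are bounded, so the greatest one exists.\<close>
    have bound: "t \<le> N" if "?P t" for t
    proof -
      have "1 * 1 \<le> exp 1 * real t" using that e by (intro mult_mono) auto
      then have "1 \<le> exp 1 * real t" by simp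
      then have "real t powr 1 \<le> real t powr (exp 1 * real t)"
        using that by (intro powr_mono) auto
      with that show ?thesis by simp
    qed
    define t where "t = (GREATEST t. ?P t)"
    from True obtain t\<^sub>0 where "?P t\<^sub>0" by blast
    then have t: "?P t" unfolding t_def by (rule GreatestI_nat[where P = ?P]) (use bound in blast)
    have "\<not> ?P (t + 1)"
    proof
      assume "?P (t + 1)"
      then have "t + 1 \<le> t" unfolding t_def
        by (rule Greatest_le_nat[where P = ?P]) (use bound in blast)
      then show False by simp
    qed
    then have N: "real N < real (t + 1) powr (exp 1 * real (t + 1))" using t by auto
    define k where "k = nat \<lceil>exp 1 * real (t + 1)\<rceil>"
    have "real N \<le> real (fact k)"
      using N powr_le_fact[of "real (t + 1)" k] by (simp add: k_def real_nat_ceiling_ge)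
    then have "N \<le> fact k" by (simp only: of_nat_le_iff)
    moreover have "real k \<le> exp 1 * real t + exp 1 + 1"
      unfolding k_def using of_int_ceiling_le_add_one[of "exp 1 * real (t + 1)"]
      by (simp add: distrib_left add.commute)
    moreover have "exp 1 * real t \<le> log (real t) (real N)"
      using t assms by (subst le_log_iff) auto
    moreover have "tpar N = t" using True by (simp add: tpar_def t_def)
    ultimately show ?thesis using e(2) by (intro exI[of _ k] conjI) simp_all
  next
    case False
    \<comment> \<open>Already \<open>t = 2\<close> fails, so \<open>N\<close> is below an absolute
      constant; the generous choice \<open>k = 9\<close> accounts for the additive 9.\<close>
    then have "real N < 2 powr (exp 1 * 2)"
      by (metis le_refl not_le of_nat_numeral)
    also have "\<dots> \<le> 2 powr 6" using e by (intro powr_mono) auto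
    also have "\<dots> = 64" by simp
    finally have "N \<le> fact 9" by (simp add: fact_numeral)
    moreover have "tpar N = 2" using False by (auto simp: tpar_def)
    moreover have "0 \<le> log 2 (real N)" using assms by simp
    ultimately show ?thesis by (intro exI[of _ 9]) auto
  qed
qed

section \<open>The final count\<close>

lemma separable_bound:
  assumes "length w = n" "n \<ge> 1" "B \<subseteq> {w'. length w' = n} - {w}" "card B \<le> fact k"
  shows "\<exists>r. separable w B r \<and> real r \<le> log 2 (real n) + real k + 4"
proof (cases "n \<le> k")
  case True
  have "separable w B n" by (rule separable_short) (use assms in auto)
  moreover have "0 \<le> log 2 (real n)" using assms(2) by simp
  ultimately show ?thesis using True by (intro exI[of _ n]) auto
next
  case False
  \<comment> \<open>The factor 3 costs at most 2 since \<open>log 2 3 \<le> 2\<close>, and rounding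
    up costs 1; the quantifier choosing the position supplies the remaining 1 of the additive
    4.\<close>
  define m where "m = nat \<lceil>log 2 (3 * real n)\<rceil>"
  have "log 2 (3 * real n) \<le> real m" by (simp add: m_def real_nat_ceiling_ge)
  then have "3 * real n \<le> 2 powr real m" using assms(2) by (subst (asm) log_le_iff) auto
  then have "real (3 * n) \<le> real (2 ^ m)" by (simp add: powr_realpow)
  then have 3: "3 * n \<le> 2 ^ m" by (simp only: of_nat_le_iff)
  have "0 \<le> log 2 (3 * real n)" using assms(2) by simp
  then have "real m \<le> log 2 (3 * real n) + 1" unfolding m_def by linarith
  also have "\<dots> = log 2 3 + log 2 (real n) + 1" using assms(2) by (simp add: log_mult)
  also have "log 2 3 \<le> log 2 (4::real)" by simp
  also have "log 2 (4::real) = 2" using log_pow_cancel[of "2::real" 2] by simp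
  finally have m: "real m \<le> log 2 (real n) + 3" by simp
  have "finite {w' :: bool list. length w' = n}"
    using finite_lists_length_eq[of "UNIV :: bool set" n] by simp
  then have "finite B" using assms(3) by (auto intro: finite_subset)
  then have "separable w B (k + (m + 1))"
    by (intro separable_long) (use assms False 3 in auto)
  then show ?thesis using m by (intro exI[of _ "k + (m + 1)"]) auto
qed

theorem mainTheorem14:
  shows "\<exists>C::real. \<forall>(f::nat \<Rightarrow> nat) (N::nat).
     (\<forall>n. f n \<le> N) \<and> (\<exists>n. f n = N) \<longrightarrow>
     (\<forall>n (w::bool list) (B::bool list set).
        n \<ge> 1 \<and> length w = n \<and> B \<subseteq> {w'. length w' = n} - {w} \<and> card B = f n \<longrightarrow>
        (\<exists>\<phi>. sentence \<phi> \<and>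
              real (qcount \<phi>) \<le> log 2 (real n) + log (real (tpar N)) (real N) + C \<and>
              models w \<phi> \<and> (\<forall>w'\<in>B. \<not> models w' \<phi>)))"
\<comment> \<open>13 = 9 + 4: 9 from the choice of \<open>k\<close>, 4 from locating a
  position.\<close>
proof (intro exI[of _ 13] allI impI)
  fix f :: "nat \<Rightarrow> nat" and N n :: nat and w :: "bool list" and B :: "bool list set"
  assume f: "(\<forall>n. f n \<le> N) \<and> (\<exists>n. f n = N)"
    and B: "n \<ge> 1 \<and> length w = n \<and> B \<subseteq> {w'. length w' = n} - {w} \<and> card B = f n"
  have "\<exists>k. N \<le> fact k \<and> real k \<le> log (real (tpar N)) (real N) + 9"
  proof (cases "N = 0")
    case True
    \<comment> \<open>By convention \<open>ln 0 = 0\<close>, so the logarithm of \<open>N\<close> is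
      0 here.\<close>
    then show ?thesis by (intro exI[of _ 0]) (simp add: log_def)
  next
    case False
    then show ?thesis by (intro le_fact_tpar) simp
  qed
  then obtain k where k: "N \<le> fact k" "real k \<le> log (real (tpar N)) (real N) + 9" by blast
  have "card B \<le> fact k" using f B k(1) by (metis le_trans)
  then obtain r where r: "separable w B r" "real r \<le> log 2 (real n) + real k + 4"
    using separable_bound[of w n B k] B by blast
  then obtain \<phi> where "sentence \<phi>" "qcount \<phi> \<le> r" "models w \<phi>" "\<forall>w'\<in>B. \<not> models w' \<phi>"
    unfolding separable_def by blast
  moreover from this(2) r(2) k(2)
  have "real (qcount \<phi>) \<le> log 2 (real n) + log (real (tpar N)) (real N) + 13" by linarith
  ultimately show "\<exists>\<phi>. sentence \<phi> \<and>
      real (qcount \<phi>) \<le> log 2 (real n) + log (real (tpar N)) (real N) + 13 \<and>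
      models w \<phi> \<and> (\<forall>w'\<in>B. \<not> models w' \<phi>)" by blast
qed

end
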